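(* Let $r\geq 2$ be an integer, let $n$ be a positive integer, let $c$ be a real number with $2/\ln n\leq c\leq r^{-(r+8)r}$, and let $G$ be a graph of order $n$. If $G$ contains a complete graph $K_{r+1}$ and has minimum degree $\delta(G)>(1-1/r-1/r^4)n$, then $G$ contains a (not necessarily induced) subgraph isomorphic to $K_r^+\left(\lfloor c\ln n\rfloor,\ldots,\lfloor c\ln n\rfloor,\lceil n^{1-cr^3}\rceil\right)$, where the first $r-1$ parts have size $\lfloor c\ln n\rfloor$ and the last part has size $\lceil n^{1-cr^3}\rceil$.
   Context: For integers $s_1\geq 2,s_2,\ldots,s_r\geq 1$, $K_r^+(s_1,\ldots,s_r)$ denotes the complete $r$-partite graph with parts of sizes $s_1,\ldots,s_r$ together with one additional edge joining two vertices of the first part (the part of size $s_1$). $\delta(G)$ denotes the minimum degree of $G$. *)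

theory Defs
  imports Complex_Main "Graph_Theory.Graph_Theory"
begin

text \<open>
  A finite simple graph is a \<open>pair_graph\<close>, i.e. a finite, symmetric, loop-free digraph whose
  arcs are pairs of vertices. An undirected edge is the pair of opposite arcs \<open>(u, v)\<close>,
  \<open>(v, u)\<close>, so the degree of a vertex is its out-degree.
\<close>

definition min_degree :: "'a pair_pre_digraph \<Rightarrow> nat" where
  "min_degree G = Min (out_degree (with_proj G) ` pverts G)"

definition contains_complete :: "'a pair_pre_digraph \<Rightarrow> nat \<Rightarrow> bool" where
  "contains_complete G k \<longleftrightarrow>
     (\<exists>H :: 'a pair_pre_digraph. subgraph (with_proj H) (with_proj G) \<and> complete_digraph k (with_proj H))"

definition contains_copy :: "'a pair_pre_digraph \<Rightarrow> 'b pair_pre_digraph \<Rightarrow> bool" where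
  "contains_copy G K \<longleftrightarrow>
     (\<exists>H :: 'a pair_pre_digraph. subgraph (with_proj H) (with_proj G) \<and> digraph_iso (with_proj H) (with_proj K))"

text \<open>
  Part sizes are given as a list \<open>[s\<^sub>1, \<dots>, s\<^sub>r]\<close>. Parts are indexed from \<open>0\<close>, and the vertex
  \<open>(i, a)\<close> is the \<open>a\<close>-th vertex of part \<open>i\<close>.
\<close>

definition complete_multipartite :: "nat list \<Rightarrow> (nat \<times> nat) pair_pre_digraph" where
  "complete_multipartite s =
     \<lparr> pverts = {(i, a). i < length s \<and> a < s ! i},
       parcs = {((i, a), (j, b)). i < length s \<and> a < s ! i \<and> j < length s \<and> b < s ! j \<and> i \<noteq> j} \<rparr>"

text \<open>
  The graph \<open>K\<^sub>r\<^sup>+(s\<^sub>1, \<dots>, s\<^sub>r)\<close>; meaningful only if \<open>s\<^sub>1 \<ge> 2\<close>, since otherwise the added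
  edge leaves the vertex set.
\<close>

definition complete_multipartite_plus :: "nat list \<Rightarrow> (nat \<times> nat) pair_pre_digraph" where
  "complete_multipartite_plus s =
     \<lparr> pverts = pverts (complete_multipartite s),
       parcs = parcs (complete_multipartite s) \<union> {((0, 0), (0, 1)), ((0, 1), (0, 0))} \<rparr>"

end

theory Submission
  imports Defs
begin

text \<open>
  Double counting over the edges of the given \<open>K\<^sub>r\<^sub>+\<^sub>1\<close> yields an edge \<open>uv\<close> whose common neighbourhood
  \<open>W\<close> exceeds the generic size \<open>(1 - 2/r)n\<close> by order \<open>n/r\<^sup>3\<close>. By the degree condition, cliques
  \<open>w\<^sub>1, \<dots>, w\<^sub>r\<^sub>-\<^sub>2\<close> can then be chosen greedily in \<open>W\<close> with a positive proportion of choices at each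
  step, followed by a vertex \<open>x\<close> not required to lie in \<open>W\<close> and a last vertex of \<open>W\<close>.

  Such a tree of choices is blown up one coordinate at a time: given many coordinatewise distinct
  tuples whose entries in different coordinates are all adjacent, a Kovari-Sos-Turan argument finds a
  constant proportion of them with polynomially many common extensions, and distinct extensions are
  attached to distinct tuples. As only graph edges between coordinates matter, the tuples
  lose a constant factor per step, which the upper bound on \<open>c\<close> absorbs. In the last step all
  common extensions are kept and form the large part. Finally \<open>u\<close> and \<open>v\<close> join the part of the
  vertices \<open>x\<close>, since they are adjacent to all of \<open>W\<close>.
\<close>

subsection \<open>Complete bipartite subgraphs of dense bipartite graphs\<close>

lemma sum_card_swap:
  assumes "finite A" "finite B"
  shows "(\<Sum>a\<in>A. card {b\<in>B. R a b}) = (\<Sum>b\<in>B. card {a\<in>A. R a b})"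
  by (rule sum_multicount_gen) (use assms in auto)

text \<open>Averaging: at least \<open>2 * \<theta> * card V * card I\<close> pairs are related.
  Elements of \<open>V\<close> below the threshold account for at most half of this amount, and each
  of the others for at most \<open>card I\<close>.\<close>

lemma card_ge_half_density:
  fixes \<theta> :: real
  assumes "finite I" "finite V" "I \<noteq> {}" "\<theta> \<ge> 0"
    and deg: "\<And>i. i \<in> I \<Longrightarrow> real (card {a\<in>V. R i a}) \<ge> 2 * \<theta> * card V"
  shows "real (card {a\<in>V. real (card {i\<in>I. R i a}) \<ge> \<theta> * card I}) \<ge> \<theta> * card V"
proof -
  let ?g = "{a\<in>V. real (card {i\<in>I. R i a}) \<ge> \<theta> * card I}"
  have "2 * \<theta> * card V * card I = (\<Sum>i\<in>I. 2 * \<theta> * card V)" by simp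
  also have "\<dots> \<le> (\<Sum>i\<in>I. real (card {a\<in>V. R i a}))" by (intro sum_mono deg)
  also have "\<dots> = (\<Sum>a\<in>V. real (card {i\<in>I. R i a}))"
    using arg_cong[OF sum_card_swap[OF assms(1,2), of R], of real] by simp
  also have "\<dots> \<le> (\<Sum>a\<in>V. (if a \<in> ?g then real (card I) else 0) + \<theta> * card I)"
  proof (rule sum_mono)
    fix a assume "a \<in> V"
    have "card {i\<in>I. R i a} \<le> card I" using assms(1) by (auto intro: card_mono)
    then show "real (card {i\<in>I. R i a}) \<le> (if a \<in> ?g then real (card I) else 0) + \<theta> * card I"
      using \<open>a \<in> V\<close> \<open>\<theta> \<ge> 0\<close> by (auto simp: add_increasing2)
  qed
  also have "\<dots> = card ?g * card I + \<theta> * card I * card V"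
  proof -
    have "(\<Sum>a\<in>V. if a \<in> ?g then real (card I) else 0) = (\<Sum>a\<in>?g. real (card I))"
      using assms(2) by (intro sum.mono_neutral_cong_right) auto
    then show ?thesis by (simp add: sum.distrib)
  qed
  finally have "\<theta> * card V * card I \<le> card ?g * card I" by (simp add: algebra_simps)
  moreover have "real (card I) > 0" using assms by (simp add: card_gt_0_iff)
  ultimately show ?thesis by (simp add: mult_le_cancel_right)
qed

text \<open>\<open>S\<close> grows by one element at a time. Since \<open>d\<close> exceeds
  \<open>\<gamma> * card I\<close> by at least \<open>s\<close>, every element of \<open>T\<close>
  keeps \<open>\<gamma> * card I\<close> partners outside the current \<open>S\<close>, so by
  averaging some new \<open>i\<close> is related to a proportion \<open>\<gamma>\<close> of
  \<open>T\<close>.\<close>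

lemma greedy_complete_bipartite:
  fixes \<gamma> d :: real
  assumes "finite I" "finite V" "V \<noteq> {}" "\<gamma> > 0"
    and deg: "\<And>a. a \<in> V \<Longrightarrow> real (card {i\<in>I. R i a}) \<ge> d"
    and "\<gamma> * card I + s \<le> d"
  shows "\<exists>S T. S \<subseteq> I \<and> card S = s \<and> T \<subseteq> V \<and> (\<forall>i\<in>S. \<forall>a\<in>T. R i a) \<and>
           real (card T) \<ge> \<gamma> ^ s * card V"
  using assms(6)
proof (induction s)
  case 0
  show ?case by (intro exI[of _ "{}"] exI[of _ V]) auto
next
  case (Suc s)
  then obtain S T where ST: "S \<subseteq> I" "card S = s" "T \<subseteq> V" "\<forall>i\<in>S. \<forall>a\<in>T. R i a"
    "real (card T) \<ge> \<gamma> ^ s * card V" by auto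
  have fin: "finite S" "finite T" using ST assms finite_subset by blast+
  have "card V > 0" using assms by (simp add: card_gt_0_iff)
  then have "card T > 0" using ST(5) \<open>\<gamma> > 0\<close>
    by (smt (verit, best) mult_pos_pos of_nat_0_less_iff zero_less_power)
  let ?J = "I - S"
  have dT: "real (card {i\<in>?J. R i a}) \<ge> \<gamma> * card I" if "a \<in> T" for a
  proof -
    have "{i\<in>I. R i a} \<subseteq> {i\<in>?J. R i a} \<union> S" by auto
    then have "card {i\<in>I. R i a} \<le> card {i\<in>?J. R i a} + card S"
      using fin assms(1) by (intro order_trans[OF card_mono card_Un_le]) auto
    then show ?thesis using deg[of a] that ST Suc.prems by auto
  qed
  have "\<exists>i\<in>?J. real (card {a\<in>T. R i a}) \<ge> \<gamma> * card T"
  proof (rule ccontr)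
    assume *: "\<not> ?thesis"
    \<comment> \<open>The strict comparison of sums needs \<open>I - S\<close> to be nonempty; the
      degree of any element of \<open>T\<close> already forces
      \<open>card S < card I\<close>.\<close>
    obtain a where "a \<in> T" using \<open>card T > 0\<close> by fastforce
    have "\<gamma> * card I + Suc s \<le> real (card I)"
      using Suc.prems deg[of a] \<open>a \<in> T\<close> ST(3) card_mono[of I "{i\<in>I. R i a}"] assms(1) by force
    then have "card S < card I" using ST(2) \<open>\<gamma> > 0\<close>
      by (smt (verit, best) Suc_le_eq mult_nonneg_nonneg of_nat_0_le_iff of_nat_le_iff)
    then have "?J \<noteq> {}" using fin(1) by (metis Diff_eq_empty_iff card_mono linorder_not_less)
    then have "(\<Sum>i\<in>?J. real (card {a\<in>T. R i a})) < (\<Sum>i\<in>?J. \<gamma> * card T)"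
      using * assms(1) by (intro sum_strict_mono) (simp_all add: not_le)
    also have "\<dots> \<le> card I * (\<gamma> * card T)"
      using \<open>\<gamma> > 0\<close> assms(1) card_mono[of I ?J] by (simp add: mult_right_mono)
    also have "\<dots> = (\<Sum>a\<in>T. \<gamma> * card I)" by simp
    also have "\<dots> \<le> (\<Sum>a\<in>T. real (card {i\<in>?J. R i a}))" by (intro sum_mono dT)
    also have "\<dots> = (\<Sum>i\<in>?J. real (card {a\<in>T. R i a}))"
      using arg_cong[OF sum_card_swap[of ?J T R], of real] fin assms(1) by simp
    finally show False by simp
  qed
  then obtain i where i: "i \<in> ?J" "real (card {a\<in>T. R i a}) \<ge> \<gamma> * card T" by blast
  have "\<gamma> ^ Suc s * card V \<le> \<gamma> * card T" using ST(5) \<open>\<gamma> > 0\<close> by simp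
  then show ?case using i ST fin
    by (intro exI[of _ "insert i S"] exI[of _ "{a\<in>T. R i a}"]) auto
qed

text \<open>Restricting \<open>V\<close> to elements related to half the average share of
  \<open>I\<close> costs a factor \<open>\<beta> / 2\<close>. The greedy choice then runs with
  \<open>\<gamma> = \<beta> / 4\<close>, and the other \<open>\<beta> / 4\<close> of the degree
  absorbs \<open>s\<close>.\<close>

lemma dense_bipartite_contains_complete:
  fixes \<beta> :: real
  assumes "finite I" "finite V" "V \<noteq> {}" "\<beta> > 0"
    and deg: "\<And>i. i \<in> I \<Longrightarrow> real (card {a\<in>V. R i a}) \<ge> \<beta> * card V"
    and s: "real s \<le> \<beta> / 4 * card I" "s > 0"
  shows "\<exists>S T. S \<subseteq> I \<and> card S = s \<and> T \<subseteq> V \<and> (\<forall>i\<in>S. \<forall>a\<in>T. R i a) \<and>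
           real (card T) \<ge> \<beta> / 2 * (\<beta> / 4) ^ s * card V"
proof -
  define U where "U = {a\<in>V. real (card {i\<in>I. R i a}) \<ge> \<beta> / 2 * card I}"
  have "I \<noteq> {}" using s by auto
  then have U: "real (card U) \<ge> \<beta> / 2 * card V"
    unfolding U_def using assms by (intro card_ge_half_density) auto
  have "card V > 0" using assms by (simp add: card_gt_0_iff)
  then have "\<beta> / 2 * card V > 0" using \<open>\<beta> > 0\<close> by simp
  then have "U \<noteq> {}" using U by auto
  then obtain S T where ST: "S \<subseteq> I" "card S = s" "T \<subseteq> U" "\<forall>i\<in>S. \<forall>a\<in>T. R i a"
    "real (card T) \<ge> (\<beta> / 4) ^ s * card U"
    using greedy_complete_bipartite[of I U "\<beta> / 4" "\<beta> / 2 * card I" R s] assms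
    by (auto simp: U_def)
  have "(\<beta> / 4) ^ s * (\<beta> / 2 * card V) \<le> (\<beta> / 4) ^ s * card U"
    using U \<open>\<beta> > 0\<close> by (intro mult_left_mono) auto
  moreover have "T \<subseteq> V" using ST(3) U_def by auto
  ultimately show ?thesis using ST by (intro exI[of _ S] exI[of _ T]) (auto simp: mult_ac)
qed

subsection \<open>Joined families of cliques\<close>

text \<open>
  Each \<open>y i\<close> is a \<open>k\<close>-tuple, and the \<open>j\<close>-th entries form the \<open>j\<close>-th part of a complete \<open>k\<close>-partite
  graph with parts of size \<open>card I\<close>.
\<close>

definition joined_tuples :: "('a \<Rightarrow> 'a \<Rightarrow> bool) \<Rightarrow> nat \<Rightarrow> 'i set \<Rightarrow> ('i \<Rightarrow> 'a list) \<Rightarrow> bool" where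
  "joined_tuples adj k I y \<longleftrightarrow> finite I \<and> (\<forall>i\<in>I. length (y i) = k) \<and>
     (\<forall>i\<in>I. \<forall>i'\<in>I. \<forall>j<k. \<forall>j'<k. j \<noteq> j' \<longrightarrow> adj (y i ! j) (y i' ! j')) \<and>
     (\<forall>j<k. inj_on (\<lambda>i. y i ! j) I)"

lemma joined_tuples_subset: "joined_tuples adj k I y \<Longrightarrow> S \<subseteq> I \<Longrightarrow> joined_tuples adj k S y"
  unfolding joined_tuples_def by (meson finite_subset inj_on_subset subsetD)

lemma joined_tuples_Cons:
  assumes "symp adj" "joined_tuples adj k S y" "inj_on f S"
    and adj: "\<And>i i' b. i \<in> S \<Longrightarrow> i' \<in> S \<Longrightarrow> b \<in> set (y i') \<Longrightarrow> adj (f i) b"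
  shows "joined_tuples adj (Suc k) S (\<lambda>i. f i # y i)"
proof -
  have y: "finite S" "\<And>i. i \<in> S \<Longrightarrow> length (y i) = k"
    "\<And>i i' j j'. i \<in> S \<Longrightarrow> i' \<in> S \<Longrightarrow> j < k \<Longrightarrow> j' < k \<Longrightarrow> j \<noteq> j' \<Longrightarrow> adj (y i ! j) (y i' ! j')"
    "\<And>j. j < k \<Longrightarrow> inj_on (\<lambda>i. y i ! j) S"
    using assms(2) unfolding joined_tuples_def by blast+
  have a: "adj (f i) (y i' ! j)" if "i \<in> S" "i' \<in> S" "j < k" for i i' j
    using adj[of i i'] y(2)[of i'] that by simp
  have a': "adj (y i' ! j) (f i)" if "i \<in> S" "i' \<in> S" "j < k" for i i' j
    using a[OF that] \<open>symp adj\<close> by (meson sympD)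
  have "adj ((f i # y i) ! j) ((f i' # y i') ! j')"
    if "i \<in> S" "i' \<in> S" "j < Suc k" "j' < Suc k" "j \<noteq> j'" for i i' j j'
    using that y(3) a a' by (cases j; cases j') auto
  moreover have "inj_on (\<lambda>i. (f i # y i) ! j) S" if "j < Suc k" for j
    using that y(4) assms(3) by (cases j) auto
  ultimately show ?thesis
    unfolding joined_tuples_def using y(1,2) by simp
qed

text \<open>All elements of \<open>T\<close> extend all tuples of \<open>S\<close>, and the second
  size condition gives \<open>card T >= m\<close>, so an injection of \<open>S\<close> into
  \<open>T\<close> attaches distinct new entries. \<open>Q\<close> may demand more than adjacency,
  which lets a new entry carry a property needed for the next coordinate.\<close>

lemma joined_tuples_extend:
  fixes \<beta> :: real
  assumes "symp adj" "joined_tuples adj k I y" "finite V" "\<beta> > 0" "m > 0"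
    and deg: "\<And>i. i \<in> I \<Longrightarrow> real (card {a\<in>V. Q i a}) \<ge> \<beta> * card V"
    and Q: "\<And>i a b. i \<in> I \<Longrightarrow> Q i a \<Longrightarrow> b \<in> set (y i) \<Longrightarrow> adj a b"
    and m: "real m \<le> \<beta> / 4 * card I" "real m \<le> \<beta> / 2 * (\<beta> / 4) ^ m * card V"
  obtains S f where "S \<subseteq> I" "card S = m" "joined_tuples adj (Suc k) S (\<lambda>i. f i # y i)"
    "\<And>i. i \<in> S \<Longrightarrow> f i \<in> V \<and> Q i (f i)"
proof -
  have "finite I" using assms(2) by (simp add: joined_tuples_def)
  have "V \<noteq> {}" using m \<open>m > 0\<close> by auto
  then obtain S T where ST: "S \<subseteq> I" "card S = m" "T \<subseteq> V" "\<And>i a. i \<in> S \<Longrightarrow> a \<in> T \<Longrightarrow> Q i a"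
    "real (card T) \<ge> \<beta> / 2 * (\<beta> / 4) ^ m * card V"
    using dense_bipartite_contains_complete[of I V \<beta> Q m] \<open>finite I\<close> assms(3-5) deg m(1) by metis
  have "card S \<le> card T" using ST m by linarith
  moreover have "finite S" "finite T" using ST assms(3) \<open>finite I\<close> finite_subset by blast+
  ultimately obtain f where f: "f ` S \<subseteq> T" "inj_on f S" using card_le_inj[of S T] by blast
  have "joined_tuples adj (Suc k) S (\<lambda>i. f i # y i)"
  proof (rule joined_tuples_Cons[OF assms(1) joined_tuples_subset[OF assms(2) ST(1)] f(2)])
    fix i i' b assume "i \<in> S" "i' \<in> S" "b \<in> set (y i')"
    then show "adj (f i) b" using ST(1,4) f(1) by (intro Q[of i']) auto
  qed
  then show ?thesis using ST f by (intro that[of S f]) auto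
qed

text \<open>Here \<open>m l\<close> is the family size once \<open>l\<close> coordinates are built.
  New entries are sought in \<open>V\<close> with membership in \<open>W\<close> moved into the
  relation, so every density is measured against \<open>card V\<close>.\<close>

lemma joined_tuples_in_set:
  fixes \<beta> :: real and m :: "nat \<Rightarrow> nat"
  assumes "symp adj" "finite V" "W \<subseteq> V" "\<beta> > 0"
    and ext: "\<And>z. set z \<subseteq> W \<Longrightarrow> length z < k \<Longrightarrow>
                real (card {a\<in>W. \<forall>b\<in>set z. adj a b}) \<ge> \<beta> * card V"
    and m: "\<And>l. l < k \<Longrightarrow> m (Suc l) > 0"
      "\<And>l. l < k \<Longrightarrow> real (m (Suc l)) \<le> \<beta> / 4 * m l"
      "\<And>l. l < k \<Longrightarrow> real (m (Suc l)) \<le> \<beta> / 2 * (\<beta> / 4) ^ m (Suc l) * card V"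
  shows "\<exists>(I :: nat set) y. card I = m k \<and> joined_tuples adj k I y \<and> (\<forall>i\<in>I. set (y i) \<subseteq> W)"
  using ext m
proof (induction k)
  case 0
  show ?case by (rule exI[of _ "{..<m 0}"], rule exI[of _ "\<lambda>_. []"]) (simp add: joined_tuples_def)
next
  case (Suc k)
  obtain I :: "nat set" and y where Iy: "card I = m k" "joined_tuples adj k I y"
    "\<forall>i\<in>I. set (y i) \<subseteq> W" using Suc.IH[OF Suc.prems] by auto
  have len: "\<And>i. i \<in> I \<Longrightarrow> length (y i) = k" using Iy by (simp add: joined_tuples_def)
  obtain S f where S: "S \<subseteq> I" "card S = m (Suc k)"
    "joined_tuples adj (Suc k) S (\<lambda>i. f i # y i)"
    "\<And>i. i \<in> S \<Longrightarrow> f i \<in> V \<and> (f i \<in> W \<and> (\<forall>b\<in>set (y i). adj (f i) b))"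
  proof (rule joined_tuples_extend[OF assms(1) Iy(2) assms(2,4), of "m (Suc k)"
        "\<lambda>i a. a \<in> W \<and> (\<forall>b\<in>set (y i). adj a b)"])
    fix i assume "i \<in> I"
    have "{a \<in> V. a \<in> W \<and> (\<forall>b\<in>set (y i). adj a b)} = {a\<in>W. \<forall>b\<in>set (y i). adj a b}"
      using assms(3) by auto
    then show "real (card {a \<in> V. a \<in> W \<and> (\<forall>b\<in>set (y i). adj a b)}) \<ge> \<beta> * card V"
      using Suc.prems(1)[of "y i"] Iy(3) len \<open>i \<in> I\<close> by simp
  qed (use Suc.prems Iy in auto)
  then show ?case using Iy(3) by (intro exI[of _ S] exI[of _ "\<lambda>i. f i # y i"]) auto
qed

section \<open>Common neighbourhoods and an edge of large codegree\<close>

lemma card_common_neighbours: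
  fixes \<epsilon> :: real
  assumes "finite V" "A \<subseteq> V" "set z \<subseteq> V"
    and deg: "\<And>b. b \<in> V \<Longrightarrow> real (card {a\<in>V. adj a b}) \<ge> card V - \<epsilon>"
  shows "real (card {a\<in>A. \<forall>b\<in>set z. adj a b}) \<ge> card A - length z * \<epsilon>"
  using assms(3)
proof (induction z)
  case Nil
  then show ?case by simp
next
  case (Cons b z)
  let ?C = "{a\<in>A. \<forall>c\<in>set z. adj a c}"
  have "finite A" using assms finite_subset by blast
  have "{a\<in>V. \<not> adj a b} = V - {a\<in>V. adj a b}" by auto
  then have "card {a\<in>V. \<not> adj a b} = card V - card {a\<in>V. adj a b}"
    using assms(1) by (simp add: card_Diff_subset)
  moreover have "card {a\<in>V. adj a b} \<le> card V" using assms(1) by (auto intro: card_mono)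
  ultimately have "real (card {a\<in>V. \<not> adj a b}) \<le> \<epsilon>"
    using deg[of b] Cons.prems by (simp add: of_nat_diff)
  moreover have "card ?C \<le> card {a\<in>A. \<forall>c\<in>set (b # z). adj a c} + card {a\<in>V. \<not> adj a b}"
    using assms \<open>finite A\<close> by (intro order_trans[OF card_mono card_Un_le]) auto
  ultimately show ?case using Cons by (auto simp: algebra_simps)
qed

lemma card_off_diagonal:
  assumes "finite D"
  shows "card {(u, v). u \<in> D \<and> v \<in> D \<and> u \<noteq> v} = card D * (card D - 1)"
proof -
  have "{(u, v). u \<in> D \<and> v \<in> D \<and> u \<noteq> v} = (SIGMA u:D. D - {u})" by auto
  then show ?thesis using assms by simp
qed

text \<open>With \<open>d a\<close> the number of neighbours of \<open>a\<close> in
  \<open>K\<close>, the codegrees of the ordered pairs from \<open>K\<close> sum to the total of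
  \<open>d a * (d a - 1)\<close>. At integers this quadratic lies above its chord through
  \<open>r - 1\<close> and \<open>r\<close>; the chord is linear, so the degree bound evaluates its
  sum, and some pair reaches the average.\<close>

lemma clique_edge_large_codegree:
  fixes \<eta> :: real
  assumes "finite V" "K \<subseteq> V" "card K = r + 1" "r \<ge> 1"
    and deg: "\<And>b. b \<in> V \<Longrightarrow> real (card {a\<in>V. adj a b}) \<ge> (1 - \<eta>) * card V"
  obtains u v where "u \<in> K" "v \<in> K" "u \<noteq> v"
    "real (card {a\<in>V. adj a u \<and> adj a v}) \<ge>
       (2 * (real r ^ 2 - 1) * (1 - \<eta>) - r * (real r - 1)) / (real r * (real r + 1)) * card V"
proof -
  define P where "P = {(u, v). u \<in> K \<and> v \<in> K \<and> u \<noteq> v}"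
  define d where "d a = card {u\<in>K. adj a u}" for a
  define \<tau> where "\<tau> = (2 * (real r ^ 2 - 1) * (1 - \<eta>) - r * (real r - 1)) / (real r * (real r + 1))"
  have fK: "finite K" using assms finite_subset by blast
  have "finite P" unfolding P_def by (rule finite_subset[of _ "K \<times> K"]) (use fK in auto)
  have "card P = r * (r + 1)" unfolding P_def using card_off_diagonal[OF fK] assms(3) by (simp add: mult_ac)
  then have "P \<noteq> {}" using assms(4) by auto
  have "\<tau> * card V * card P = (2 * (real r ^ 2 - 1) * (1 - \<eta>) - r * (real r - 1)) * card V"
  proof -
    have cP: "real (card P) = real r * (real r + 1)" using \<open>card P = _\<close> by (simp add: algebra_simps)
    have "real r * (real r + 1) \<noteq> 0" using assms(4) by simp
    then show ?thesis unfolding \<tau>_def cP by simp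
  qed
  \<comment> \<open>\<open>r^2 - 1\<close> is read as \<open>(r - 1) * card K\<close>, which
    prepares the sum over \<open>K\<close>.\<close>
  also have "\<dots> = 2 * (real r - 1) * (card K * ((1 - \<eta>) * card V)) - r * (real r - 1) * card V"
    unfolding assms(3) by (simp add: algebra_simps power2_eq_square)
  also have "\<dots> \<le> 2 * (real r - 1) * (\<Sum>u\<in>K. real (card {a\<in>V. adj a u})) - r * (real r - 1) * card V"
  proof -
    have "card K * ((1 - \<eta>) * card V) \<le> (\<Sum>u\<in>K. real (card {a\<in>V. adj a u}))"
      using sum_bounded_below[of K "(1 - \<eta>) * card V" "\<lambda>u. real (card {a\<in>V. adj a u})"]
        deg assms(2) by auto
    then show ?thesis using assms(4) by (simp add: mult_left_mono)
  qed
  also have "(\<Sum>u\<in>K. real (card {a\<in>V. adj a u})) = (\<Sum>a\<in>V. real (d a))"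
    unfolding d_def using arg_cong[OF sum_card_swap[OF fK assms(1), of "\<lambda>u a. adj a u"], of real]
    by simp
  also have "2 * (real r - 1) * \<dots> - r * (real r - 1) * card V
      = (\<Sum>a\<in>V. 2 * (real r - 1) * d a - r * (real r - 1))"
    by (simp add: sum_subtractf sum_distrib_left)
  also have "\<dots> \<le> (\<Sum>a\<in>V. real (d a) * (real (d a) - 1))"
  proof (rule sum_mono)
    fix a
    \<comment> \<open>No integer lies strictly between \<open>r - 1\<close> and \<open>r\<close>.\<close>
    have "(int (d a) - int r) * (int (d a) - int r + 1) \<ge> 0"
      by (cases "int (d a) \<ge> int r") (auto intro: mult_nonpos_nonpos)
    then have "real_of_int ((int (d a) - int r) * (int (d a) - int r + 1)) \<ge> 0"
      by (simp only: of_int_0_le_iff)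
    then show "2 * (real r - 1) * d a - r * (real r - 1) \<le> real (d a) * (real (d a) - 1)"
      by (simp add: algebra_simps)
  qed
  also have "\<dots> = (\<Sum>a\<in>V. real (card {p\<in>P. adj a (fst p) \<and> adj a (snd p)}))"
  proof (rule sum.cong[OF refl])
    fix a
    have "{p\<in>P. adj a (fst p) \<and> adj a (snd p)} =
        {(u, v). u \<in> {u\<in>K. adj a u} \<and> v \<in> {u\<in>K. adj a u} \<and> u \<noteq> v}"
      by (auto simp: P_def)
    then have "card {p\<in>P. adj a (fst p) \<and> adj a (snd p)} = d a * (d a - 1)"
      unfolding d_def using card_off_diagonal[of "{u\<in>K. adj a u}"] fK by simp
    \<comment> \<open>At \<open>d a = 0\<close> the truncated and the real predecessor differ, but
      both products vanish.\<close>
    then show "real (d a) * (real (d a) - 1) = real (card {p\<in>P. adj a (fst p) \<and> adj a (snd p)})"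
      by (cases "d a") (auto simp: algebra_simps)
  qed
  also have "\<dots> = (\<Sum>p\<in>P. real (card {a\<in>V. adj a (fst p) \<and> adj a (snd p)}))"
    using arg_cong[OF sum_card_swap[OF assms(1) \<open>finite P\<close>, of "\<lambda>a p. adj a (fst p) \<and> adj a (snd p)"], of real]
    by simp
  finally have le: "\<tau> * card V * card P \<le> (\<Sum>p\<in>P. real (card {a\<in>V. adj a (fst p) \<and> adj a (snd p)}))" .
  have "\<exists>p\<in>P. \<tau> * card V \<le> real (card {a\<in>V. adj a (fst p) \<and> adj a (snd p)})"
  proof (rule ccontr)
    assume "\<not> ?thesis"
    then have "(\<Sum>p\<in>P. real (card {a\<in>V. adj a (fst p) \<and> adj a (snd p)})) < (\<Sum>p\<in>P. \<tau> * card V)"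
      using \<open>finite P\<close> \<open>P \<noteq> {}\<close> by (intro sum_strict_mono) (simp_all add: not_le)
    then show False using le by (simp add: mult_ac)
  qed
  then show ?thesis using that unfolding P_def \<tau>_def by auto
qed

subsection \<open>Numerical estimates\<close>

text \<open>The difference is what remains of the codegree after \<open>r - 2\<close> vertices have
  each removed their non-neighbours. It simplifies exactly to
  \<open>(r^3 - r^2 + 2r + 2) / (r^5 (r + 1))\<close>.\<close>

lemma codegree_excess:
  fixes r :: nat
  assumes "r \<ge> 2"
  shows "(2 * (real r ^ 2 - 1) * (1 - (1 / r + 1 / real r ^ 4)) - r * (real r - 1)) / (real r * (real r + 1))
           - (real r - 2) * (1 / r + 1 / real r ^ 4) \<ge> 2 / (3 * real r ^ 3)"
proof -
  have pos: "real r > 0" using assms by simp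
  then have "real r + real r * real r > 0" by (simp add: add_pos_pos)
  then have eq: "(2 * (real r ^ 2 - 1) * (1 - (1 / r + 1 / real r ^ 4)) - r * (real r - 1)) / (real r * (real r + 1))
           - (real r - 2) * (1 / r + 1 / real r ^ 4)
      = (real r ^ 3 - real r ^ 2 + 2 * r + 2) / (real r ^ 5 * (real r + 1))"
    using pos by (simp add: divide_simps) (simp add: algebra_simps eval_nat_numeral)
  \<comment> \<open>Clearing denominators leaves \<open>r (r - 2) (r - 3) + 6 >= 0\<close>, and no
    integer lies strictly between 2 and 3.\<close>
  have "(real r - 2) * (real r - 3) \<ge> 0"
    using assms by (cases "r = 2") auto
  then have "real r * ((real r - 2) * (real r - 3)) \<ge> 0" using pos by simp
  then have "2 * (real r ^ 2 * (real r + 1)) \<le> 3 * (real r ^ 3 - real r ^ 2 + 2 * r + 2)"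
    by (simp add: algebra_simps eval_nat_numeral)
  then have "2 * (real r ^ 2 * (real r + 1)) / (3 * (real r ^ 5 * (real r + 1)))
      \<le> 3 * (real r ^ 3 - real r ^ 2 + 2 * r + 2) / (3 * (real r ^ 5 * (real r + 1)))"
    using pos by (intro divide_right_mono) auto
  also have "\<dots> = (real r ^ 3 - real r ^ 2 + 2 * r + 2) / (real r ^ 5 * (real r + 1))"
    by (rule mult_divide_mult_cancel_left) simp
  finally have "2 * (real r ^ 2 * (real r + 1)) / (3 * (real r ^ 5 * (real r + 1)))
      \<le> (real r ^ 3 - real r ^ 2 + 2 * r + 2) / (real r ^ 5 * (real r + 1))" .
  moreover have "2 * (real r ^ 2 * (real r + 1)) / (3 * (real r ^ 5 * (real r + 1))) = 2 / (3 * real r ^ 3)"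
    using pos by (simp add: divide_simps)
  ultimately show ?thesis unfolding eq by (simp only:)
qed

text \<open>The claim reduces to \<open>8 (r - 1) <= r^3\<close>, an equality at
  \<open>r = 2\<close>; this fixes the constant 7/8.\<close>

lemma clique_extension_density:
  fixes r :: nat
  assumes "r \<ge> 2"
  shows "1 - (real r - 1) * (1 / r + 1 / real r ^ 4) \<ge> 7 / (8 * r)"
proof -
  have pos: "real r > 0" using assms by simp
  have "real r ^ 2 \<ge> 2 ^ 2" using assms by (intro power_mono) auto
  then have "(real r - 2) * (real r ^ 2 + 2 * r - 4) \<ge> 0" using assms by (intro mult_nonneg_nonneg) auto
  then have "8 * (real r - 1) \<le> real r ^ 3" by (simp add: algebra_simps eval_nat_numeral)
  then have "8 * (real r - 1) * r \<le> real r ^ 4" using pos by (simp add: eval_nat_numeral mult_right_mono)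
  then show ?thesis using pos by (simp add: divide_simps) (simp add: algebra_simps eval_nat_numeral)
qed

text \<open>Since \<open>1 / L <= \<beta> / 4\<close> for \<open>L = r^8\<close>, it is enough that
  \<open>n >= L^(3m)\<close>: this leaves \<open>L^(2m - 1)\<close>, which is at least
  \<open>m\<close>. That condition follows from \<open>24 r m <= ln n\<close>, which the upper bound
  on \<open>c\<close> supplies.\<close>

lemma intermediate_size_bound:
  fixes r n s m :: nat and c :: real
  assumes "r \<ge> 2" "n \<ge> 1" "c \<le> real r powr (- (real (r + 8) * real r))"
    and s: "real s \<le> c * ln n" and "s \<ge> 1"
    and m: "m \<le> s * (r ^ 8) ^ (r - 1)" "m \<ge> 1"
  defines "\<beta> \<equiv> 7 / (24 * real r ^ 4)"
  shows "real m \<le> \<beta> / 2 * (\<beta> / 4) ^ m * n"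
proof -
  define L where "L = real r ^ 8"
  have pos: "real r > 0" using assms by simp
  have r4: "real r ^ 4 \<ge> 16" using power_mono[of 2 "real r" 4] assms by simp
  have "L \<ge> 1" unfolding L_def using assms by simp
  have L: "1 / L \<le> \<beta> / 4"
  proof -
    have "16 * real r ^ 4 \<le> real r ^ 4 * real r ^ 4" using r4 by (intro mult_right_mono) auto
    also have "\<dots> = real r ^ 8" by (simp flip: power_add)
    finally have "16 * real r ^ 4 \<le> real r ^ 8" .
    then have "96 * real r ^ 4 \<le> 7 * real r ^ 8" using zero_le_power[of "real r" 8] pos by linarith
    then show ?thesis unfolding L_def \<beta>_def using pos by (simp add: field_simps)
  qed
  have "\<beta> > 0" unfolding \<beta>_def using pos by simp
  have "ln (real n) \<ge> 0" using assms by simp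
  have "real r powr (- (real (r + 8) * real r)) = 1 / real r ^ ((r + 8) * r)"
    using pos by (simp add: powr_minus_divide flip: powr_realpow)
  then have c: "c * real r ^ ((r + 8) * r) \<le> 1"
    using assms(3) pos by (simp only: pos_le_divide_eq zero_less_power)
  \<comment> \<open>The exponent splits as \<open>(r + 8) r = (r r + 8) + 8 (r - 1)\<close>: the
    second summand pays for the ratio of \<open>m\<close> to \<open>s\<close>, the first for the
    factor \<open>24 r\<close>.\<close>
  have "24 * real r * real r ^ (8 * (r - 1)) \<le> real r ^ ((r + 8) * r)"
  proof -
    have "(2::real) ^ 5 \<le> real r ^ 5" using assms by (intro power_mono) auto
    then have "24 * real r \<le> real r ^ 5 * real r" using pos by simp
    also have "\<dots> = real r ^ 6" by (simp add: eval_nat_numeral)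
    also have "\<dots> \<le> real r ^ (r * r + 8)" using assms by (intro power_increasing) auto
    finally have "24 * real r * real r ^ (8 * (r - 1)) \<le> real r ^ (r * r + 8) * real r ^ (8 * (r - 1))"
      using pos by (intro mult_right_mono) auto
    also have "\<dots> = real r ^ ((r + 8) * r)"
      using assms(1) by (simp add: algebra_simps flip: power_add)
    finally show ?thesis .
  qed
  moreover have "c * ln n > 0" using s \<open>s \<ge> 1\<close> by linarith
  ultimately have "c * ln n * (24 * real r * real r ^ (8 * (r - 1))) \<le> c * ln n * real r ^ ((r + 8) * r)"
    by (intro mult_left_mono) auto
  also have "\<dots> \<le> ln n" using mult_right_mono[OF c \<open>ln (real n) \<ge> 0\<close>] by (simp add: mult_ac)
  finally have 1: "24 * r * (c * ln n * real r ^ (8 * (r - 1))) \<le> ln n" by (simp add: mult_ac)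
  have "real m \<le> s * real r ^ (8 * (r - 1))"
    using m(1) by (metis of_nat_le_iff of_nat_mult of_nat_power power_mult)
  also have "\<dots> \<le> c * ln n * real r ^ (8 * (r - 1))" using s pos by (intro mult_right_mono) auto
  finally have "24 * r * real m \<le> 24 * r * (c * ln n * real r ^ (8 * (r - 1)))"
    by (intro mult_left_mono) auto
  with 1 have "24 * r * real m \<le> ln n" by linarith
  moreover have "ln (real r) \<le> r" using ln_le_minus_one[of "real r"] pos by linarith
  then have "24 * real m * ln r \<le> 24 * real m * r" by (intro mult_left_mono) auto
  ultimately have "ln (real r ^ (24 * m)) \<le> ln n" using pos by (simp add: ln_realpow mult_ac)
  then have "real r ^ (24 * m) \<le> n" using pos assms(2) by simp
  then have n: "L ^ (3 * m) \<le> n" unfolding L_def by (simp flip: power_mult)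
  have "m < 2 ^ m" by simp
  then have "real m \<le> 2 ^ m" by (metis less_imp_le of_nat_le_iff of_nat_numeral of_nat_power)
  also have "\<dots> \<le> L ^ m" unfolding L_def using assms(1)
    by (intro power_mono order_trans[OF _ self_le_power[of "real r" 8]]) auto
  also have "\<dots> \<le> L ^ (2 * m - 1)" using \<open>L \<ge> 1\<close> m(2) by (intro power_increasing) auto
  also have "\<dots> = (1 / L) ^ (m + 1) * L ^ (3 * m)"
  proof -
    have "L ^ (3 * m) = L ^ (2 * m - 1) * L ^ (m + 1)"
      using m(2) by (simp flip: power_add del: power_Suc)
    then show ?thesis using \<open>L \<ge> 1\<close> by (simp add: power_one_over)
  qed
  also have "\<dots> \<le> (\<beta> / 4) ^ (m + 1) * n"
    using L n \<open>L \<ge> 1\<close> \<open>\<beta> > 0\<close> by (intro mult_mono power_mono) auto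
  also have "\<dots> \<le> \<beta> / 2 * (\<beta> / 4) ^ m * n"
    using \<open>\<beta> > 0\<close> by (simp add: mult_right_mono)
  finally show ?thesis .
qed

text \<open>The estimate of the large part is nearly tight for \<open>r = s = 2\<close>, where it needs \<open>exp 16 \<ge> (1536/7)\<^sup>3 / 2\<close>.\<close>

lemma exp_16_ge: "exp (16::real) \<ge> 6000000"
proof -
  have "(41 / 32 :: real) \<le> exp (1 / 4)"
    using exp_lower_Taylor_quadratic[of "1/4::real"] by (simp add: power2_eq_square)
  then have "(41 / 32 :: real) ^ 64 \<le> exp (1 / 4) ^ 64" by (intro power_mono) auto
  also have "exp (1 / 4 :: real) ^ 64 = exp 16" by (simp flip: exp_of_nat_mult)
  finally have "(41 / 32 :: real) ^ 64 \<le> exp 16" .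
  moreover have "(6000000 :: real) \<le> (41 / 32) ^ 64" by (simp add: power_divide)
  ultimately show ?thesis by linarith
qed

text \<open>With \<open>b = 4 / \<beta>\<close> the right side is \<open>2 n / b^(s + 1)\<close>, so
  it suffices that \<open>b^(s + 1) / 2 <= exp (s r^3)\<close>. The first two units of
  \<open>s\<close> are covered by \<open>b^3 / 2 <= exp (2 r^3)\<close>, each further one by
  \<open>b <= exp (r^3)\<close>.\<close>

lemma final_size_bound:
  fixes r n s :: nat and c :: real
  assumes "r \<ge> 2" "n \<ge> 1" and s: "real s \<le> c * ln n" "s \<ge> 2"
  defines "\<beta> \<equiv> 7 / (24 * real r ^ 4)"
  shows "real n powr (1 - c * real r ^ 3) \<le> \<beta> / 2 * (\<beta> / 4) ^ s * n"
proof -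
  have pos: "real r > 0" using assms by simp
  \<comment> \<open>The scaling puts the extremal case \<open>r = 2\<close> at \<open>x = 1\<close>,
    where \<open>x <= exp (x - 1)\<close> is an equality.\<close>
  define x where "x = real r / 2"
  define b where "b = 4 / \<beta>"
  have "\<beta> > 0" unfolding \<beta>_def using pos by simp
  have b: "b = 1536 / 7 * x ^ 4" unfolding b_def \<beta>_def x_def using pos by (simp add: field_simps)
  have "x \<ge> 1" unfolding x_def using assms by simp
  have "b \<ge> 1" unfolding b using one_le_power[OF \<open>x \<ge> 1\<close>, of 4] by simp
  have x12: "x ^ 12 \<le> exp (12 * (x - 1))"
  proof -
    have "x \<le> exp (x - 1)" using exp_ge_add_one_self[of "x - 1"] by simp
    then have "x ^ 12 \<le> exp (x - 1) ^ 12" using \<open>x \<ge> 1\<close> by (intro power_mono) auto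
    then show ?thesis by (simp flip: exp_of_nat_mult)
  qed
  have "b ^ 3 / 2 = (1536 / 7) ^ 3 / 2 * x ^ 12" 
    unfolding b by (simp only: power_mult_distrib flip: power_mult) simp
  also have "\<dots> \<le> 6000000 * x ^ 12"
    using \<open>x \<ge> 1\<close> by (intro mult_right_mono) (simp_all add: power_divide)
  also have "\<dots> \<le> exp 16 * exp (12 * (x - 1))" using exp_16_ge x12 \<open>x \<ge> 1\<close> by (intro mult_mono) auto
  also have "\<dots> = exp (12 * x + 4)" by (simp flip: exp_add)
  also have "\<dots> \<le> exp (2 * real r ^ 3)"
  proof -
    have "x ^ 3 \<ge> x" using self_le_power[of x 3] \<open>x \<ge> 1\<close> by simp
    moreover have "real r ^ 3 = 8 * x ^ 3" unfolding x_def by (simp add: power_divide)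
    ultimately show ?thesis using \<open>x \<ge> 1\<close> by simp
  qed
  finally have b3: "b ^ 3 / 2 \<le> exp (2 * real r ^ 3)" .
  have "b ^ 2 \<le> exp (2 * real r ^ 3)"
  proof -
    have "b \<ge> 2" unfolding b using one_le_power[OF \<open>x \<ge> 1\<close>, of 4] by simp
    then have "b ^ 2 * 2 \<le> b ^ 2 * b" by (intro mult_left_mono) auto
    then have "b ^ 2 \<le> b ^ 3 / 2" by (simp add: eval_nat_numeral)
    with b3 show ?thesis by linarith
  qed
  also have "\<dots> = exp (real r ^ 3) ^ 2" by (simp flip: exp_of_nat_mult)
  finally have b1: "b \<le> exp (real r ^ 3)" by (rule power2_le_imp_le) simp
  have "b ^ (s + 1) / 2 = b ^ 3 / 2 * b ^ (s - 2)"
    using s(2) by (simp flip: power_add)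
  also have "\<dots> \<le> exp (2 * real r ^ 3) * exp (real r ^ 3) ^ (s - 2)"
    using b3 b1 \<open>b \<ge> 1\<close> by (intro mult_mono power_mono) auto
  also have "\<dots> = exp (s * real r ^ 3)"
    using s(2) by (simp add: of_nat_diff algebra_simps flip: exp_of_nat_mult exp_add)
  also have "\<dots> \<le> exp (c * ln n * real r ^ 3)" using s(1) pos by (simp add: mult_right_mono)
  finally have main: "b ^ (s + 1) / 2 \<le> exp (c * ln n * real r ^ 3)" .
  have "real n powr (1 - c * real r ^ 3) = n / exp (c * ln n * real r ^ 3)"
    using assms(2) by (simp add: powr_def algebra_simps exp_diff)
  also have "\<dots> \<le> n / (b ^ (s + 1) / 2)"
    using main \<open>b \<ge> 1\<close> by (intro divide_left_mono) auto
  also have "\<dots> = \<beta> / 2 * (\<beta> / 4) ^ s * n"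
    unfolding b_def using \<open>\<beta> > 0\<close> by (simp add: field_simps)
  finally show ?thesis .
qed

subsection \<open>Embedding the extended multipartite graph\<close>

lemma contains_copy_if_embedding:
  assumes "wf_digraph (with_proj G)" "wf_digraph (with_proj K)"
    and \<phi>: "inj_on \<phi> (pverts K)" "\<phi> ` pverts K \<subseteq> pverts G"
    and arcs: "\<And>a b. (a, b) \<in> parcs K \<Longrightarrow> (\<phi> a, \<phi> b) \<in> parcs G"
  shows "contains_copy G K"
proof -
  define h where "h = \<lparr>iso_verts = \<phi>, iso_arcs = map_prod \<phi> \<phi>, iso_head = snd, iso_tail = fst\<rparr>"
  define H where "H = \<lparr>pverts = \<phi> ` pverts K, parcs = map_prod \<phi> \<phi> ` parcs K\<rparr>"
  have K: "parcs K \<subseteq> pverts K \<times> pverts K"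
    using wf_digraph.tail_in_verts[OF assms(2)] wf_digraph.head_in_verts[OF assms(2)]
    by fastforce
  have wfH: "wf_digraph (with_proj H)"
    unfolding wf_digraph_def using K by (auto simp: H_def)
  have "inj_on (map_prod \<phi> \<phi>) (parcs K)"
    by (rule inj_on_subset[OF map_prod_inj_on[OF \<phi>(1) \<phi>(1)] K])
  then have "pre_digraph.digraph_isomorphism (with_proj K) h"
    unfolding pre_digraph.digraph_isomorphism_def using assms by (auto simp: h_def)
  moreover have "with_proj H = app_iso h (with_proj K)"
    by (simp add: app_iso_def H_def h_def with_proj_def)
  ultimately have "digraph_iso (with_proj K) (with_proj H)" unfolding digraph_iso_def by blast
  then have "digraph_iso (with_proj H) (with_proj K)"
    using digraph_iso_swap assms(2) by blast
  moreover have "subgraph (with_proj H) (with_proj G)"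
    unfolding subgraph_def using assms(1) wfH \<phi>(2) arcs by (auto simp: H_def compatible_def)
  ultimately show ?thesis unfolding contains_copy_def by blast
qed

lemma wf_complete_multipartite_plus:
  assumes "l \<noteq> []" "l ! 0 \<ge> 2"
  shows "wf_digraph (with_proj (complete_multipartite_plus l))"
  unfolding wf_digraph_def using assms
  by (auto simp: complete_multipartite_plus_def complete_multipartite_def)

text \<open>Each part is enumerated by a repetition-free list. The list of part 0 starts with
  \<open>u, v\<close>, so the added edge between \<open>(0, 0)\<close> and \<open>(0, 1)\<close>
  lands on \<open>uv\<close>. Different parts are disjoint because a shared vertex would carry a
  loop.\<close>

lemma contains_complete_multipartite_plus:
  assumes "pair_graph G" "l \<noteq> []" "l ! 0 \<ge> 2"
    and A: "\<And>i. i < length l \<Longrightarrow> A i \<subseteq> pverts G \<and> l ! i \<le> card (A i)"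
    and adj: "\<And>i j a b. i < length l \<Longrightarrow> j < length l \<Longrightarrow> i \<noteq> j \<Longrightarrow> a \<in> A i \<Longrightarrow> b \<in> A j \<Longrightarrow> (a, b) \<in> parcs G"
    and uv: "u \<in> A 0" "v \<in> A 0" "(u, v) \<in> parcs G"
  shows "contains_copy G (complete_multipartite_plus l)"
proof -
  interpret pair_graph G by fact
  have fin: "finite (A i)" if "i < length l" for i using A[OF that] finite_subset pair_finite_verts by blast
  have "u \<noteq> v" using no_loops[OF uv(3)] by auto
  have "(v, u) \<in> parcs G" using uv(3) arcs_symmetric by blast
  have "\<exists>xs. distinct xs \<and> set xs \<subseteq> A i \<and> l ! i \<le> length xs \<and> (i = 0 \<longrightarrow> xs ! 0 = u \<and> xs ! 1 = v)"
    if i: "i < length l" for i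
  proof (cases "i = 0")
    case False
    obtain xs where "set xs = A i" "distinct xs" using finite_distinct_list[OF fin[OF i]] by blast
    then show ?thesis using A[OF i] False distinct_card[of xs] by (intro exI[of _ xs]) simp
  next
    case True
    have "finite (A 0 - {u, v})" using fin[OF i] True by simp
    from finite_distinct_list[OF this]
    obtain xs where xs: "set xs = A 0 - {u, v}" "distinct xs" by blast
    have xs': "set (u # v # xs) = A 0" "distinct (u # v # xs)"
      using xs uv(1,2) \<open>u \<noteq> v\<close> by auto
    then have "length (u # v # xs) = card (A 0)" by (metis distinct_card)
    then show ?thesis using A[OF i] True xs' by (intro exI[of _ "u # v # xs"]) simp
  qed
  then have "\<forall>i\<in>{..<length l}. \<exists>xs. distinct xs \<and> set xs \<subseteq> A i \<and> l ! i \<le> length xs \<and>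
      (i = 0 \<longrightarrow> xs ! 0 = u \<and> xs ! 1 = v)" by blast
  from bchoice[OF this] obtain X where
    X': "\<forall>i\<in>{..<length l}. distinct (X i) \<and> set (X i) \<subseteq> A i \<and> l ! i \<le> length (X i) \<and>
      (i = 0 \<longrightarrow> X i ! 0 = u \<and> X i ! 1 = v)" ..
  then have X: "\<And>i. i < length l \<Longrightarrow> distinct (X i) \<and> set (X i) \<subseteq> A i \<and> l ! i \<le> length (X i)"
    by simp
  have X0: "X 0 ! 0 = u" "X 0 ! 1 = v" using bspec[OF X', of 0] assms(2) by auto
  define \<phi> where "\<phi> = (\<lambda>(i, a). X i ! a)"
  have mem: "X i ! a \<in> A i" if "i < length l" "a < l ! i" for i a
    using X[OF that(1)] that(2) by (meson less_le_trans nth_mem subsetD)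
  have ne: "X i ! a \<noteq> X j ! b" if "i < length l" "a < l ! i" "j < length l" "b < l ! j" "i \<noteq> j" for i j a b
    using adj[OF that(1,3,5) mem[OF that(1,2)] mem[OF that(3,4)]] no_loops by force
  show ?thesis
  proof (rule contains_copy_if_embedding[where \<phi> = \<phi>])
    show "wf_digraph (with_proj (complete_multipartite_plus l))"
      using assms by (intro wf_complete_multipartite_plus)
    show "inj_on \<phi> (pverts (complete_multipartite_plus l))"
    proof (rule inj_onI, clarsimp simp: complete_multipartite_plus_def complete_multipartite_def \<phi>_def)
      fix i a j b
      assume h: "X i ! a = X j ! b" "i < length l" "a < l ! i" "j < length l" "b < l ! j"
      then have "i = j" using ne by blast
      then show "i = j \<and> a = b" using h X[of i] by (simp add: nth_eq_iff_index_eq)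
    qed
    show "\<phi> ` pverts (complete_multipartite_plus l) \<subseteq> pverts G"
      using mem A by (force simp: complete_multipartite_plus_def complete_multipartite_def \<phi>_def)
    show "(\<phi> a, \<phi> b) \<in> parcs G" if "(a, b) \<in> parcs (complete_multipartite_plus l)" for a b
      using that mem adj X0 uv(3) \<open>(v, u) \<in> parcs G\<close>
      by (auto simp: complete_multipartite_plus_def complete_multipartite_def \<phi>_def)
  qed (rule wf_digraph_axioms)
qed

subsection \<open>Assembling the parts\<close>

text \<open>The order of choice is reversed: each \<open>w\<close> in \<open>W\<close> extending
  \<open>z\<close> has a proportion \<open>7 / (8r) = 2 * \<theta>\<close> of \<open>V\<close>
  adjacent to all of \<open>w # z\<close>. Averaging over \<open>w\<close> gives many
  \<open>x\<close> that see a proportion \<open>\<theta>\<close> of these \<open>w\<close>, and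
  \<open>\<beta> = \<theta> * 2 / (3 r^3)\<close>.\<close>

lemma many_dense_clique_extensions:
  fixes r :: nat and \<eta> \<beta> :: real
  assumes "r \<ge> 2" "finite V" "W \<subseteq> V" "set z \<subseteq> W" "length z = r - 2" "symp adj" "V \<noteq> {}"
    and \<eta>: "\<eta> = 1 / r + 1 / real r ^ 4" and \<beta>: "\<beta> = 7 / (24 * real r ^ 4)"
    and deg: "\<And>b. b \<in> V \<Longrightarrow> real (card {a\<in>V. adj a b}) \<ge> card V - \<eta> * card V"
    and B: "real (card {w\<in>W. \<forall>b\<in>set z. adj w b}) \<ge> 2 / (3 * real r ^ 3) * card V"
  shows "real (card {x\<in>V. (\<forall>b\<in>set z. adj x b) \<and>
           real (card {w\<in>W. \<forall>b\<in>set (x # z). adj w b}) \<ge> \<beta> * card V}) \<ge> \<beta> * card V"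
proof -
  define B where "B = {w\<in>W. \<forall>b\<in>set z. adj w b}"
  define \<theta> where "\<theta> = 7 / (16 * real r)"
  have pos: "real r > 0" using assms(1) by simp
  have "finite W" using assms(2,3) finite_subset by blast
  have "finite B" "B \<subseteq> V" using \<open>finite W\<close> assms(3) by (auto simp: B_def)
  have "card V > 0" using assms(2,7) by (simp add: card_gt_0_iff)
  then have "2 / (3 * real r ^ 3) * card V > 0" using pos by simp
  then have "B \<noteq> {}" using assms(11) unfolding B_def[symmetric] by auto
  have "real (card {a\<in>V. \<forall>b\<in>set (w # z). adj a b}) \<ge> 2 * \<theta> * card V" if "w \<in> B" for w
  proof -
    have "2 * \<theta> * card V \<le> (1 - (real r - 1) * \<eta>) * card V"
      using clique_extension_density[OF assms(1)] unfolding \<theta>_def \<eta> by (intro mult_right_mono) auto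
    also have "\<dots> = card V - length (w # z) * (\<eta> * card V)"
      using assms(1,5) by (simp add: of_nat_diff algebra_simps)
    also have "\<dots> \<le> real (card {a\<in>V. \<forall>b\<in>set (w # z). adj a b})"
      using assms(2,3,4) deg that \<open>B \<subseteq> V\<close> by (intro card_common_neighbours[of V]) auto
    finally show ?thesis .
  qed
  from card_ge_half_density[OF \<open>finite B\<close> assms(2) \<open>B \<noteq> {}\<close> _ this]
  have "\<theta> * card V \<le> card {a\<in>V. real (card {w\<in>B. \<forall>b\<in>set (w # z). adj a b}) \<ge> \<theta> * card B}"
    by (simp add: \<theta>_def)
  also have "\<dots> \<le> card {x\<in>V. (\<forall>b\<in>set z. adj x b) \<and>
           real (card {w\<in>W. \<forall>b\<in>set (x # z). adj w b}) \<ge> \<beta> * card V}"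
  proof (intro of_nat_mono card_mono subsetI)
    fix a assume "a \<in> {a\<in>V. real (card {w\<in>B. \<forall>b\<in>set (w # z). adj a b}) \<ge> \<theta> * card B}"
    then have a: "a \<in> V" "real (card {w\<in>B. \<forall>b\<in>set (w # z). adj a b}) \<ge> \<theta> * card B" by auto
    have "\<beta> * card V = \<theta> * (2 / (3 * real r ^ 3) * card V)"
      unfolding \<theta>_def \<beta> using pos by (simp add: field_simps eval_nat_numeral)
    also have "\<dots> \<le> \<theta> * card B"
      using assms(11) pos unfolding B_def \<theta>_def by (intro mult_left_mono) auto
    finally have ge: "\<beta> * card V \<le> real (card {w\<in>B. \<forall>b\<in>set (w # z). adj a b})" using a by linarith
    \<comment> \<open>One such \<open>w\<close> suffices to see that \<open>a\<close> is adjacent to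
      all of \<open>z\<close>, because the condition on \<open>w # z\<close> includes
      \<open>z\<close>.\<close>
    have "\<beta> * card V > 0" using \<open>card V > 0\<close> pos unfolding \<beta> by simp
    with ge have "card {w\<in>B. \<forall>b\<in>set (w # z). adj a b} \<noteq> 0" by linarith
    then have "{w\<in>B. \<forall>b\<in>set (w # z). adj a b} \<noteq> {}" by (metis card.empty)
    then have "\<forall>b\<in>set z. adj a b" by auto
    moreover have "card {w\<in>B. \<forall>b\<in>set (w # z). adj a b} \<le> card {w\<in>W. \<forall>b\<in>set (a # z). adj w b}"
      using \<open>finite W\<close> sympD[OF \<open>symp adj\<close>] by (intro card_mono) (auto simp: B_def)
    then have "\<beta> * card V \<le> card {w\<in>W. \<forall>b\<in>set (a # z). adj w b}" using ge by linarith
    ultimately show "a \<in> {x\<in>V. (\<forall>b\<in>set z. adj x b) \<and>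
           real (card {w\<in>W. \<forall>b\<in>set (x # z). adj w b}) \<ge> \<beta> * card V}" using a(1) by blast
  qed (use assms(2) in auto)
  finally have "\<theta> * card V \<le> \<dots>" .
  moreover have "\<beta> \<le> \<theta>"
  proof -
    have "real r ^ 1 \<le> real r ^ 4" using assms(1) by (intro power_increasing) auto
    then have "real r * 2 \<le> 3 * real r ^ 4" unfolding power_one_right using pos by linarith
    then show ?thesis unfolding \<beta> \<theta>_def using pos by (simp add: field_simps)
  qed
  then have "\<beta> * card V \<le> \<theta> * card V" by (intro mult_right_mono) auto
  ultimately show ?thesis by linarith
qed

text \<open>
  The constant \<open>\<beta>\<close> is half the product of \<open>2/(3r\<^sup>3)\<close>, the density of extensions of an \<open>(r-2)\<close>-clique
  inside \<open>W\<close>, and \<open>7/(8r)\<close>, the density of extensions of an \<open>(r-1)\<close>-clique inside \<open>V\<close>.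
\<close>

lemma dense_graph_parts_around_edge:
  fixes r s :: nat and \<beta> :: real and adj :: "'a \<Rightarrow> 'a \<Rightarrow> bool"
  assumes "r \<ge> 2" "finite V" "symp adj"
    and K: "K \<subseteq> V" "card K = r + 1" "\<And>u v. u \<in> K \<Longrightarrow> v \<in> K \<Longrightarrow> u \<noteq> v \<Longrightarrow> adj u v"
    and deg: "\<And>b. b \<in> V \<Longrightarrow> real (card {a\<in>V. adj a b}) \<ge> (1 - (1 / r + 1 / real r ^ 4)) * card V"
    and \<beta>: "\<beta> = 7 / (24 * real r ^ 4)"
    and s: "s \<ge> 2"
      "\<And>m. m \<ge> 1 \<Longrightarrow> m \<le> s * (r ^ 8) ^ (r - 1) \<Longrightarrow> real m \<le> \<beta> / 2 * (\<beta> / 4) ^ m * card V"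
  obtains A u v where "u \<in> A 0" "v \<in> A 0" "adj u v"
    "\<And>i. i < r \<Longrightarrow> A i \<subseteq> V" "\<And>i. i < r - 1 \<Longrightarrow> s \<le> card (A i)"
    "real (card (A (r - 1))) \<ge> \<beta> / 2 * (\<beta> / 4) ^ s * card V"
    "\<And>i j a b. i < r \<Longrightarrow> j < r \<Longrightarrow> i \<noteq> j \<Longrightarrow> a \<in> A i \<Longrightarrow> b \<in> A j \<Longrightarrow> adj a b"
proof -
  define \<eta> where "\<eta> = 1 / r + 1 / real r ^ 4"
  \<comment> \<open>Sizes are planned backwards from \<open>m r = s\<close>. Each step retains only
    a share \<open>\<beta> / 4\<close>, and \<open>\<beta> / 4 * r^8 >= 1\<close> makes the factor
    \<open>r^8\<close> enough.\<close>
  define m where "m k = s * (r ^ 8) ^ (r - k)" for k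
  have pos: "real r > 0" using assms(1) by simp
  then have "\<beta> > 0" unfolding \<beta> by simp
  have "V \<noteq> {}" using K by auto
  have deg': "\<And>b. b \<in> V \<Longrightarrow> real (card {a\<in>V. adj a b}) \<ge> card V - \<eta> * card V"
    using deg by (simp add: \<eta>_def algebra_simps)
  obtain u v where uv: "u \<in> K" "v \<in> K" "u \<noteq> v" and
    cod: "real (card {a\<in>V. adj a u \<and> adj a v}) \<ge>
       (2 * (real r ^ 2 - 1) * (1 - \<eta>) - r * (real r - 1)) / (real r * (real r + 1)) * card V"
    by (rule clique_edge_large_codegree[OF assms(2) K(1,2) _ deg[folded \<eta>_def]])
      (use assms(1) in simp_all)
  define W where "W = {a\<in>V. adj a u \<and> adj a v}"
  have "W \<subseteq> V" by (auto simp: W_def)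
  have Wz: "real (card {a\<in>W. \<forall>b\<in>set z. adj a b}) \<ge> 2 / (3 * real r ^ 3) * card V"
    if "set z \<subseteq> W" "length z \<le> r - 2" for z
  proof -
    have "2 / (3 * real r ^ 3) * card V \<le>
      ((2 * (real r ^ 2 - 1) * (1 - \<eta>) - r * (real r - 1)) / (real r * (real r + 1)) - (real r - 2) * \<eta>) * card V"
      using codegree_excess[OF assms(1)] unfolding \<eta>_def by (intro mult_right_mono) auto
    also have "\<dots> \<le> card W - (real r - 2) * (\<eta> * card V)" using cod unfolding W_def by (simp add: left_diff_distrib)
    also have "\<dots> \<le> card W - length z * (\<eta> * card V)"
      using that(2) assms(1) by (intro diff_mono mult_right_mono) (auto simp: \<eta>_def)
    also have "\<dots> \<le> real (card {a\<in>W. \<forall>b\<in>set z. adj a b})"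
      using assms(2) \<open>W \<subseteq> V\<close> that(1) deg' by (intro card_common_neighbours[of V]) auto
    finally show ?thesis .
  qed
  have \<beta>le: "\<beta> \<le> 2 / (3 * real r ^ 3)"
  proof -
    have "real r ^ 3 \<le> real r ^ 4" using assms(1) by (intro power_increasing) auto
    then have "7 * real r ^ 3 \<le> 16 * real r ^ 4" using zero_le_power[of "real r" 4] by linarith
    then show ?thesis unfolding \<beta> using pos by (simp add: field_simps)
  qed
  have m_pos: "m k \<ge> 1" for k using s(1) assms(1) by (simp add: m_def Suc_le_eq)
  have m_step: "real (m (Suc k)) \<le> \<beta> / 4 * m k" if "k < r" for k
  proof -
    have "real r ^ 4 \<ge> 16" using power_mono[of 2 "real r" 4] assms(1) by simp
    then have "1 \<le> \<beta> / 4 * real r ^ 8"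
      unfolding \<beta> using pos by (simp add: field_simps) (simp add: eval_nat_numeral)
    then have "real (m (Suc k)) * 1 \<le> real (m (Suc k)) * (\<beta> / 4 * real r ^ 8)" by (intro mult_left_mono) auto
    moreover have "m k = m (Suc k) * r ^ 8"
      unfolding m_def using that by (simp add: Suc_diff_Suc flip: power_Suc2)
    ultimately show ?thesis by (simp add: mult_ac)
  qed
  have m_V: "real (m (Suc k)) \<le> \<beta> / 2 * (\<beta> / 4) ^ m (Suc k) * card V" if "k < r" for k
  proof -
    have "m (Suc k) \<le> s * (r ^ 8) ^ (r - 1)"
      unfolding m_def using assms(1) by (intro mult_left_mono power_increasing) auto
    then show ?thesis using s(2) m_pos by blast
  qed
  \<comment> \<open>For \<open>r = 2\<close> the tuples are empty and only the number of indices
    matters.\<close>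
  have "\<exists>(I :: nat set) y. card I = m (r - 2) \<and> joined_tuples adj (r - 2) I y \<and> (\<forall>i\<in>I. set (y i) \<subseteq> W)"
  proof (rule joined_tuples_in_set[OF assms(3,2) \<open>W \<subseteq> V\<close> \<open>\<beta> > 0\<close>])
    fix z assume "set z \<subseteq> W" "length z < r - 2"
    then have "2 / (3 * real r ^ 3) * card V \<le> real (card {a\<in>W. \<forall>b\<in>set z. adj a b})" by (intro Wz) auto
    moreover have "\<beta> * card V \<le> 2 / (3 * real r ^ 3) * card V" using \<beta>le by (intro mult_right_mono) auto
    ultimately show "\<beta> * card V \<le> real (card {a\<in>W. \<forall>b\<in>set z. adj a b})" by linarith
  next
    fix l assume "l < r - 2"
    then have "l < r" by simp
    then show "m (Suc l) > 0" "real (m (Suc l)) \<le> \<beta> / 4 * m l"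
      "real (m (Suc l)) \<le> \<beta> / 2 * (\<beta> / 4) ^ m (Suc l) * card V"
      using m_pos[of "Suc l"] m_step m_V by auto
  qed
  then obtain I :: "nat set" and y where I: "card I = m (r - 2)" "joined_tuples adj (r - 2) I y"
    "\<And>i. i \<in> I \<Longrightarrow> set (y i) \<subseteq> W" by blast
  have len: "\<And>i. i \<in> I \<Longrightarrow> length (y i) = r - 2" using I(2) by (simp add: joined_tuples_def)
  have Suc: "Suc (r - 2) = r - 1" "Suc (r - 1) = r" using assms(1) by auto
  have r: "r - 2 < r" "r - 1 < r" using assms(1) by auto
  \<comment> \<open>The entry \<open>f i\<close> is drawn from \<open>V\<close>, not from
    \<open>W\<close>; the last conjunct of \<open>f\<close> reserves enough vertices of
    \<open>W\<close> for the final part.\<close>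
  obtain J f where J: "J \<subseteq> I" "card J = m (r - 1)" "joined_tuples adj (r - 1) J (\<lambda>i. f i # y i)"
    and f: "\<And>i. i \<in> J \<Longrightarrow> f i \<in> V \<and> (\<forall>b\<in>set (y i). adj (f i) b) \<and>
           real (card {w\<in>W. \<forall>b\<in>set (f i # y i). adj w b}) \<ge> \<beta> * card V"
  proof (rule joined_tuples_extend[OF assms(3) I(2) assms(2) \<open>\<beta> > 0\<close>, of "m (r - 1)"
        "\<lambda>i x. (\<forall>b\<in>set (y i). adj x b) \<and> real (card {w\<in>W. \<forall>b\<in>set (x # y i). adj w b}) \<ge> \<beta> * card V"])
    show "m (r - 1) > 0" using m_pos[of "r - 1"] by simp
    show "real (m (r - 1)) \<le> \<beta> / 4 * card I" using m_step[OF r(1)] I(1) Suc by simp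
    show "real (m (r - 1)) \<le> \<beta> / 2 * (\<beta> / 4) ^ m (r - 1) * card V" using m_V[OF r(1)] Suc by simp
    fix i assume "i \<in> I"
    then show "\<beta> * card V \<le> real (card {x\<in>V. (\<forall>b\<in>set (y i). adj x b) \<and>
        real (card {w\<in>W. \<forall>b\<in>set (x # y i). adj w b}) \<ge> \<beta> * card V})"
      using I(3) len Wz deg'
      by (intro many_dense_clique_extensions[OF assms(1,2) \<open>W \<subseteq> V\<close> _ _ assms(3) \<open>V \<noteq> {}\<close> \<eta>_def \<beta>]) auto
  qed (use Suc in auto)
  have "finite J" using J(3) by (simp add: joined_tuples_def)
  \<comment> \<open>The last coordinate is not matched injectively to tuples: \<open>T\<close> is
    kept whole, and only the tuples are cut down to \<open>s\<close>.\<close>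
  have "\<exists>S T. S \<subseteq> J \<and> card S = s \<and> T \<subseteq> V \<and>
      (\<forall>i\<in>S. \<forall>w\<in>T. w \<in> W \<and> (\<forall>b\<in>set (f i # y i). adj w b)) \<and>
      real (card T) \<ge> \<beta> / 2 * (\<beta> / 4) ^ s * card V"
  proof (rule dense_bipartite_contains_complete[OF \<open>finite J\<close> assms(2) \<open>V \<noteq> {}\<close> \<open>\<beta> > 0\<close>])
    fix i assume "i \<in> J"
    moreover have "{a\<in>V. a \<in> W \<and> (\<forall>b\<in>set (f i # y i). adj a b)} = {w\<in>W. \<forall>b\<in>set (f i # y i). adj w b}"
      using \<open>W \<subseteq> V\<close> by auto
    ultimately show "\<beta> * card V \<le> real (card {a\<in>V. a \<in> W \<and> (\<forall>b\<in>set (f i # y i). adj a b)})"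
      using f by presburger
  next
    have "m r = s" by (simp add: m_def)
    then show "real s \<le> \<beta> / 4 * card J" using m_step[OF r(2)] Suc J(2) by simp
    show "s > 0" using s(1) by simp
  qed
  then obtain S T where S: "S \<subseteq> J" "card S = s"
    and T: "T \<subseteq> V" "\<And>i w. i \<in> S \<Longrightarrow> w \<in> T \<Longrightarrow> w \<in> W \<and> (\<forall>b\<in>set (f i # y i). adj w b)"
      "real (card T) \<ge> \<beta> / 2 * (\<beta> / 4) ^ s * card V" by blast
  define x where "x i = f i # y i" for i
  \<comment> \<open>Entries of \<open>x i\<close> from position 1 on lie in \<open>W\<close> and so
    are adjacent to \<open>u\<close> and \<open>v\<close>. Position 0 holds \<open>f i\<close>,
    which may lie outside \<open>W\<close> and therefore shares a part with \<open>u\<close> and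
    \<open>v\<close>.\<close>
  define A where "A j =
      (if j = 0 then {u, v} \<union> f ` S else if j = r - 1 then T else (\<lambda>i. x i ! j) ` S)" for j
  have xS: "joined_tuples adj (r - 1) S x"
    unfolding x_def by (rule joined_tuples_subset[OF J(3) S(1)])
  then have x: "finite S" "\<And>i. i \<in> S \<Longrightarrow> length (x i) = r - 1"
    "\<And>i i' j j'. i \<in> S \<Longrightarrow> i' \<in> S \<Longrightarrow> j < r - 1 \<Longrightarrow> j' < r - 1 \<Longrightarrow> j \<noteq> j' \<Longrightarrow> adj (x i ! j) (x i' ! j')"
    "\<And>j. j < r - 1 \<Longrightarrow> inj_on (\<lambda>i. x i ! j) S"
    unfolding joined_tuples_def by blast+
  have "S \<noteq> {}" using S(2) s(1) by auto
  have T': "w \<in> W" "i \<in> S \<Longrightarrow> j < r - 1 \<Longrightarrow> adj w (x i ! j)" if "w \<in> T" for w i j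
    using T(2)[OF _ that] \<open>S \<noteq> {}\<close> x(2)[of i] nth_mem[of j "x i"] unfolding x_def by (blast, metis)
  have xW: "x i ! j \<in> W" if "i \<in> S" "0 < j" "j < r - 1" for i j
  proof -
    have "x i ! j \<in> set (y i)"
      using that x(2)[of i] unfolding x_def by (cases j) auto
    then show ?thesis using I(3) that(1) S(1) J(1) by blast
  qed
  have f0: "f i = x i ! 0" for i by (simp add: x_def)
  have sym: "\<And>a b. adj a b \<Longrightarrow> adj b a" using \<open>symp adj\<close> by (rule sympD)
  show ?thesis
  proof (rule that[of u A v])
    show "u \<in> A 0" "v \<in> A 0" by (auto simp: A_def)
    show "adj u v" using K(3) uv by blast
    show "A i \<subseteq> V" if "i < r" for i
      using that K(1) uv f S(1) T(1) xW \<open>W \<subseteq> V\<close> unfolding A_def by (auto simp: subset_iff)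
    show "s \<le> card (A i)" if "i < r - 1" for i
    proof (cases "i = 0")
      case True
      have "inj_on f S" using x(4)[of 0] that True by (simp add: x_def)
      then have "s = card (f ` S)" using S(2) by (simp add: card_image)
      also have "\<dots> \<le> card (A 0)" using x(1) by (intro card_mono) (auto simp: A_def)
      finally show ?thesis using True by simp
    next
      case False
      then show ?thesis using that x(4)[of i] S(2) by (simp add: A_def card_image)
    qed
    show "real (card (A (r - 1))) \<ge> \<beta> / 2 * (\<beta> / 4) ^ s * card V"
      using T(3) assms(1) by (simp add: A_def)
    \<comment> \<open>For \<open>i < j\<close> the part of \<open>b\<close> is not the first, so
      \<open>b\<close> lies in \<open>W\<close>; the part of \<open>a\<close> is not the last, so
      \<open>a\<close> is \<open>u\<close>, \<open>v\<close> or a tuple entry.\<close>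
    have half: "adj a b" if ij: "i < j" "j < r" "a \<in> A i" "b \<in> A j" for i j a b
    proof -
      have b: "b \<in> W"
        using that T' xW by (auto simp: A_def split: if_splits)
      consider "a = u \<or> a = v" | i' where "i' \<in> S" "a = x i' ! i"
        using ij by (auto simp: A_def f0 split: if_splits)
      then show ?thesis
      proof cases
        case 1
        then show ?thesis using b sym by (auto simp: W_def)
      next
        case 2
        show ?thesis
        proof (cases "j = r - 1")
          case True
          then have "b \<in> T" using ij(4) assms(1) by (simp add: A_def)
          then show ?thesis using T'(2)[of b i' i] 2 that True sym by auto
        next
          case False
          then have "b \<in> (\<lambda>i. x i ! j) ` S" using ij by (simp add: A_def)
          then show ?thesis using ij 2 x(3) False by auto
        qed
      qed
    qed
    show "adj a b" if "i < r" "j < r" "i \<noteq> j" "a \<in> A i" "b \<in> A j" for i j a b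
      using half[of i j a b] half[of j i b a] that sym by (cases "i < j") auto
  qed
qed

theorem theorem5:
  fixes r n :: nat and c :: real and G :: "'a pair_pre_digraph"
  assumes "r \<ge> 2"
    and "n \<ge> 1"
    and "2 / ln (real n) \<le> c"
    and "c \<le> real r powr (- (real (r + 8) * real r))"
    and "pair_graph G"
    and "card (pverts G) = n"
    and "contains_complete G (r + 1)"
    and "real (min_degree G) > (1 - 1 / real r - 1 / real r ^ 4) * real n"
  shows "contains_copy G
    (complete_multipartite_plus
      (replicate (r - 1) (nat \<lfloor>c * ln (real n)\<rfloor>) @ [nat \<lceil>real n powr (1 - c * real r ^ 3)\<rceil>]))"
proof -
  interpret pair_graph G by fact
  define s where "s = nat \<lfloor>c * ln (real n)\<rfloor>"
  define t where "t = nat \<lceil>real n powr (1 - c * real r ^ 3)\<rceil>"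
  define adj where "adj a b \<longleftrightarrow> (a, b) \<in> parcs G" for a b
  define \<beta> where "\<beta> = 7 / (24 * real r ^ 4)"
  obtain H :: "'a pair_pre_digraph" where H: "pverts H \<subseteq> pverts G" "parcs H \<subseteq> parcs G"
    "card (pverts H) = r + 1" "parcs H = {(u, v). (u, v) \<in> pverts H \<times> pverts H \<and> u \<noteq> v}"
    using assms(7) unfolding contains_complete_def subgraph_def complete_digraph_def by auto
  \<comment> \<open>The clique forces \<open>n >= 3\<close>, hence \<open>ln n > 0\<close>, and the
    lower bound on \<open>c\<close> becomes \<open>c * ln n >= 2\<close>: the first part has room
    for the added edge.\<close>
  have "r + 1 \<le> n" using card_mono[OF pair_finite_verts H(1)] H(3) assms(6) by simp
  then have "ln (real n) > 0" using assms(1) by simp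
  then have cln: "c * ln n \<ge> 2" using assms(3) by (simp add: field_simps)
  then have s: "s \<ge> 2" "real s \<le> c * ln n" unfolding s_def by linarith+
  have sym: "symp adj" unfolding adj_def by (rule sympI) (use arcs_symmetric in blast)
  have deg: "real (card {a\<in>pverts G. adj a b}) \<ge> (1 - (1 / r + 1 / real r ^ 4)) * card (pverts G)"
    if "b \<in> pverts G" for b
  proof -
    have "min_degree G \<le> out_degree (with_proj G) b"
      unfolding min_degree_def using that pair_finite_verts by (intro Min_le) auto
    \<comment> \<open>Arcs with tail \<open>b\<close> are determined by their heads, so counting
      arcs amounts to counting neighbours.\<close>
    also have "\<dots> = card (snd ` out_arcs (with_proj G) b)"
      unfolding out_degree_def by (rule card_image[symmetric]) (auto simp: inj_on_def out_arcs_def)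
    also have "snd ` out_arcs (with_proj G) b = {a\<in>pverts G. adj a b}"
      using arcs_symmetric in_arcsD2 by (force simp: out_arcs_def adj_def)
    finally show ?thesis using assms(6,8) by (simp add: diff_diff_eq)
  qed
  have m: "real m \<le> \<beta> / 2 * (\<beta> / 4) ^ m * card (pverts G)"
    if "m \<ge> 1" "m \<le> s * (r ^ 8) ^ (r - 1)" for m
    unfolding \<beta>_def assms(6) using that s
    by (intro intermediate_size_bound[OF assms(1,2,4) s(2)]) auto
  obtain A u v where A: "u \<in> A 0" "v \<in> A 0" "adj u v"
    "\<And>i. i < r \<Longrightarrow> A i \<subseteq> pverts G" "\<And>i. i < r - 1 \<Longrightarrow> s \<le> card (A i)"
    "real (card (A (r - 1))) \<ge> \<beta> / 2 * (\<beta> / 4) ^ s * card (pverts G)"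
    "\<And>i j a b. i < r \<Longrightarrow> j < r \<Longrightarrow> i \<noteq> j \<Longrightarrow> a \<in> A i \<Longrightarrow> b \<in> A j \<Longrightarrow> adj a b"
    by (rule dense_graph_parts_around_edge[OF assms(1) pair_finite_verts sym H(1,3) _ deg \<beta>_def s(1) m])
      (use H(2,4) in \<open>auto simp: adj_def\<close>)
  have "real n powr (1 - c * real r ^ 3) \<le> card (A (r - 1))"
    using final_size_bound[OF assms(1,2) s(2,1)] A(6) assms(6) unfolding \<beta>_def by simp
  then have t: "t \<le> card (A (r - 1))" unfolding t_def by (simp add: nat_le_iff ceiling_le_iff)
  show ?thesis
    unfolding s_def[symmetric] t_def[symmetric]
  proof (rule contains_complete_multipartite_plus[OF assms(5), where A = A])
    show "(replicate (r - 1) s @ [t]) ! 0 \<ge> 2" using assms(1) s(1) by (simp add: nth_append)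
    show "A i \<subseteq> pverts G \<and> (replicate (r - 1) s @ [t]) ! i \<le> card (A i)"
      if "i < length (replicate (r - 1) s @ [t])" for i
    proof (cases "i < r - 1")
      case True
      then show ?thesis using A(4,5) by (simp add: nth_append)
    next
      case False
      then have "i = r - 1" using that by simp
      then show ?thesis using A(4) t assms(1) by (simp add: nth_append)
    qed
  qed (use A assms(1) in \<open>auto simp: adj_def\<close>)
qed

end
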